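(* Assuming the Sparse Connectivity Conjecture, no MPC algorithm running in $o(\log n)$ rounds that computes the Hamming $k$-Single-Linkage Clustering cost of $n$ input vectors in dimension $d=2$ can achieve better than a $2$-approximation.
   Context: The Hamming distance of $u,v\in\mathbb R^d$ is $|\{i:u_i\ne v_i\}|$. The $k$-Single-Linkage Clustering cost of a point set under a distance $\rho$ is $\max$ over partitions into $k$ nonempty clusters $C_1,\dots,C_k$ of $\min_{i\ne j}\min_{a\in C_i,b\in C_j}\rho(a,b)$; a $\beta$-approximation outputs a value within a multiplicative factor $\beta$ of it. Massively Parallel Computation (MPC) model: there are $m$ machines with local memory $s=n^{\alpha}$ each (constant $\alpha<1$), with $m\cdot s=\tilde O(N)$ for input size $N$; computation proceeds in synchronous rounds, in each of which every machine performs local computation on its data and then sends and receives messages of total size at most $s$. Sparse Connectivity Conjecture: if $s=n^{\alpha}$ for a constant $\alpha<1$, solving connectivity on an input graph with $n$ vertices and $O(n)$ edges requires $\Omega(\log n)$ MPC rounds. *)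

theory Defs
  imports "HOL-Analysis.Analysis" "HOL-Library.Landau_Symbols" "HOL-Library.Disjoint_Sets"
begin

section \<open>Single-linkage clustering\<close>

definition hamming_dist :: "real ^ 'd \<Rightarrow> real ^ 'd \<Rightarrow> real" where
  "hamming_dist u v = real (card {i. u $ i \<noteq> v $ i})"

definition clustering_spacing :: "('a \<Rightarrow> 'a \<Rightarrow> real) \<Rightarrow> 'a set set \<Rightarrow> real" where
  "clustering_spacing \<rho> P =
     (MIN (C, D) \<in> {(C, D). C \<in> P \<and> D \<in> P \<and> C \<noteq> D}. MIN (a, b) \<in> C \<times> D. \<rho> a b)"

text \<open>Meaningful for a finite \<open>X\<close> and \<open>2 \<le> k \<le> card X\<close>; otherwise a minimum or maximum
  over the empty set occurs.\<close>

definition slc_cost :: "('a \<Rightarrow> 'a \<Rightarrow> real) \<Rightarrow> nat \<Rightarrow> 'a set \<Rightarrow> real" where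
  "slc_cost \<rho> k X = (MAX P \<in> {P. partition_on X P \<and> card P = k}. clustering_spacing \<rho> P)"

text \<open>The cost is the value of a maximisation problem, so the approximation guarantee is
  one-sided: the reported value does not exceed the optimum and is at least the optimum
  divided by \<open>\<beta>\<close>.\<close>

definition approximates :: "real \<Rightarrow> real \<Rightarrow> real \<Rightarrow> bool" where
  "approximates \<beta> opt v \<longleftrightarrow> v \<le> opt \<and> opt \<le> \<beta> * v"


section \<open>Massively parallel computation\<close>

text \<open>
  A program for one fixed input size. Memory contents and messages are bit strings, machines are
  numbered \<open>0, \<dots>, machines - 1\<close>, and local computation is an arbitrary function.
  \<^item> \<open>load i zs\<close> is what machine \<open>i\<close> initially stores when \<open>zs\<close> is its share of the input.
  \<^item> \<open>step r i mem inbox\<close> is the local computation of machine \<open>i\<close> in round \<open>r\<close>, given the data it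
    retained and the messages received in the previous round (indexed by sender). The result is
    the data it retains and the messages it sends (indexed by recipient).
    The empty string means that there is no message.
  \<^item> \<open>answer mem inbox\<close> is the answer, read off machine \<open>0\<close> after the last round.
\<close>

record ('a, 'b) mpc_program =
  machines :: nat
  rounds :: nat
  load :: "nat \<Rightarrow> 'a list \<Rightarrow> bool list"
  step :: "nat \<Rightarrow> nat \<Rightarrow> bool list \<Rightarrow> (nat \<Rightarrow> bool list) \<Rightarrow> bool list \<times> (nat \<Rightarrow> bool list)"
  answer :: "bool list \<Rightarrow> (nat \<Rightarrow> bool list) \<Rightarrow> 'b"

text \<open>The input records are dealt out in turn. As problems below quantify over
  all orderings of the input list, this amounts to an arbitrary balanced distribution.\<close>

definition share :: "('a, 'b) mpc_program \<Rightarrow> 'a list \<Rightarrow> nat \<Rightarrow> 'a list" where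
  "share A xs i = nths xs {j. j mod machines A = i}"

text \<open>\<open>config A xs r i\<close> is the retained data and the inbox of machine \<open>i\<close> after \<open>r\<close> rounds.\<close>

fun config :: "('a, 'b) mpc_program \<Rightarrow> 'a list \<Rightarrow> nat \<Rightarrow> nat \<Rightarrow> bool list \<times> (nat \<Rightarrow> bool list)" where
  "config A xs 0 i = (load A i (share A xs i), \<lambda>j. [])"
| "config A xs (Suc r) i =
     (let act = (\<lambda>j. step A r j (fst (config A xs r j)) (snd (config A xs r j)))
      in (fst (act i), \<lambda>j. if j < machines A then snd (act j) i else []))"

definition sent :: "('a, 'b) mpc_program \<Rightarrow> 'a list \<Rightarrow> nat \<Rightarrow> nat \<Rightarrow> nat \<Rightarrow> bool list" where
  "sent A xs r i = snd (step A r i (fst (config A xs r i)) (snd (config A xs r i)))"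

definition result :: "('a, 'b) mpc_program \<Rightarrow> 'a list \<Rightarrow> 'b" where
  "result A xs = answer A (fst (config A xs (rounds A) 0)) (snd (config A xs (rounds A) 0))"

text \<open>\<open>S\<close> is the local memory in bits and \<open>b\<close> the number of bits of one input record. Every
  machine's share of the input, its retained data together with the messages it has just received,
  and the messages it sends in a round are each limited to \<open>S\<close> bits.\<close>

definition within_memory :: "real \<Rightarrow> nat \<Rightarrow> ('a, 'b) mpc_program \<Rightarrow> 'a list \<Rightarrow> bool" where
  "within_memory S b A xs \<longleftrightarrow>
     (\<forall>i<machines A. real (length (share A xs i) * b) \<le> S) \<and>
     (\<forall>r\<le>rounds A. \<forall>i<machines A.
        real (length (fst (config A xs r i)) + (\<Sum>j<machines A. length (snd (config A xs r i) j))) \<le> S) \<and>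
     (\<forall>r<rounds A. \<forall>i<machines A. real (\<Sum>j<machines A. length (sent A xs r i j)) \<le> S)"

text \<open>
  \<open>instances n\<close> are the inputs with size parameter \<open>n\<close>, given as lists of records of
  \<open>record_bits n\<close> bits each; \<open>input_size n l\<close> is the input size (up to logarithmic factors)
  of an instance with \<open>l\<close> records; \<open>valid n xs v\<close> says that \<open>v\<close> is an acceptable answer for \<open>xs\<close>.
\<close>

record ('a, 'b) problem =
  instances :: "nat \<Rightarrow> 'a list set"
  record_bits :: "nat \<Rightarrow> nat"
  input_size :: "nat \<Rightarrow> nat \<Rightarrow> nat"
  valid :: "nat \<Rightarrow> 'a list \<Rightarrow> 'b \<Rightarrow> bool"

definition id_bits :: "nat \<Rightarrow> nat" where
  "id_bits n = nat \<lceil>log 2 (real n)\<rceil>"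

definition word_bits :: "nat \<Rightarrow> nat \<Rightarrow> nat" where
  "word_bits c n = c * id_bits n"

text \<open>
  \<open>A n l\<close> is the program for size parameter \<open>n\<close> and \<open>l\<close> input records, and \<open>T n\<close> bounds its number
  of rounds. Each machine has a memory of \<open>s = n powr \<alpha>\<close> words, a word having
  \<open>c * id_bits n\<close>, that is \<open>O(log n)\<close>, bits; the total memory satisfies \<open>m * s = N * polylog N\<close>
  for input size \<open>N\<close>. Everything is asymptotic in \<open>n\<close>: for small \<open>n\<close> the memory
  \<open>n powr \<alpha>\<close> need not even hold one record.
\<close>

definition mpc_solves ::
  "real \<Rightarrow> nat \<Rightarrow> ('a, 'b) problem \<Rightarrow> (nat \<Rightarrow> nat) \<Rightarrow> (nat \<Rightarrow> nat \<Rightarrow> ('a, 'b) mpc_program) \<Rightarrow> bool" where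
  "mpc_solves \<alpha> c Q T A \<longleftrightarrow>
     0 < c \<and>
     (\<exists>e::nat. \<forall>\<^sub>F n in sequentially. \<forall>xs \<in> instances Q n.
        real (machines (A n (length xs))) * real n powr \<alpha>
          \<le> real (input_size Q n (length xs)) * ln (real (input_size Q n (length xs))) ^ e) \<and>
     (\<forall>\<^sub>F n in sequentially. \<forall>xs \<in> instances Q n.
        0 < machines (A n (length xs)) \<and>
        rounds (A n (length xs)) \<le> T n \<and>
        within_memory (real n powr \<alpha> * real (word_bits c n)) (record_bits Q n) (A n (length xs)) xs \<and>
        valid Q n xs (result (A n (length xs)) xs))"


section \<open>Connectivity of sparse graphs\<close>

definition graph_connected :: "'v set \<Rightarrow> 'v set set \<Rightarrow> bool" where
  "graph_connected V E \<longleftrightarrow> (\<forall>u\<in>V. \<forall>v\<in>V. (u, v) \<in> {(a, b). {a, b} \<in> E}\<^sup>*)"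

text \<open>The simple graphs with vertex set \<open>{..<n}\<close> and at most \<open>C * n\<close> edges, given as a list of
  edges. An edge is represented by its two end points.\<close>

definition sparse_connectivity :: "nat \<Rightarrow> (nat set, bool) problem" where
  "sparse_connectivity C =
     \<lparr> instances = (\<lambda>n. {es. distinct es \<and> (\<forall>e\<in>set es. e \<subseteq> {..<n} \<and> card e = 2) \<and> length es \<le> C * n}),
       record_bits = (\<lambda>n. 2 * id_bits n),
       input_size = (\<lambda>n l. n + l),
       valid = (\<lambda>n es v. v \<longleftrightarrow> graph_connected {..<n} (set es)) \<rparr>"

definition sparse_connectivity_conjecture :: bool where
  "sparse_connectivity_conjecture \<longleftrightarrow>
     (\<forall>\<alpha>::real. 0 < \<alpha> \<and> \<alpha> < 1 \<longrightarrow>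
        (\<exists>C. \<forall>c T A. mpc_solves \<alpha> c (sparse_connectivity C) T A \<longrightarrow>
           (\<lambda>n. real (T n)) \<in> \<Omega>(\<lambda>n. ln (real n))))"


section \<open>Approximating the Hamming single-linkage clustering cost\<close>

text \<open>The inputs are the sets of \<open>n\<close> vectors each of whose coordinates is an integer that
  fits into one machine word.\<close>

definition hamming_slc :: "nat \<Rightarrow> nat \<Rightarrow> real \<Rightarrow> (real ^ 'd, real) problem" where
  "hamming_slc c k \<beta> =
     \<lparr> instances = (\<lambda>n. {xs. distinct xs \<and> length xs = n \<and>
                          (\<forall>x\<in>set xs. \<forall>i. x $ i \<in> real ` {..<2 ^ word_bits c n})}),
       record_bits = (\<lambda>n. CARD('d) * word_bits c n),
       input_size = (\<lambda>n l. CARD('d) * l),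
       valid = (\<lambda>n xs v. approximates \<beta> (slc_cost hamming_dist k (set xs)) v) \<rparr>"

end

theory Submission
  imports Defs
begin

text \<open>
  A graph on \<open>{..<n}\<close> is mapped to the points \<open>(u, u)\<close> for its vertices and \<open>(u, v)\<close> for its edges
  \<open>u < v\<close>. Two distinct points have Hamming distance \<open>1\<close> iff they share a coordinate, so the graph
  of pairs at distance \<open>1\<close> has the same components as the given graph. With \<open>k - 2\<close>
  further isolated points \<open>(w, w)\<close>, the optimal \<open>k\<close>-clustering has cost \<open>2\<close> if the graph is
  disconnected and \<open>1\<close> otherwise, and a better than \<open>2\<close>-approximation tells these apart. The
  reduction costs no rounds: edges are translated locally, and all other points do not depend
  on the edges, so every machine can generate its share of them by itself.
\<close>

section \<open>Bounds for the clustering cost\<close>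

lemma finite_partitions_of_card:
  assumes "finite X"
  shows "finite {P. partition_on X P \<and> card P = k}"
  using finitely_many_partition_on[OF assms] by (rule rev_finite_subset) auto

lemma finite_pairs_of_partition:
  assumes "finite X" "partition_on X P"
  shows "finite {(C, D). C \<in> P \<and> D \<in> P \<and> C \<noteq> D}"
proof -
  have "finite (P \<times> P)"
    using finite_elements[OF assms] by simp
  then show ?thesis
    by (rule rev_finite_subset) auto
qed

lemma finite_block:
  assumes "finite X" "partition_on X P" "C \<in> P"
  shows "finite C"
  using assms by (metis Sup_upper finite_subset partition_onD1)

text \<open>The hypothesis \<open>card\<close> provides two distinct clusters, so the outer minimum
  ranges over a nonempty set; blocks of a partition are nonempty, so the inner minima do as
  well.\<close>

lemma clustering_spacing_ge:
  assumes X: "finite X" "partition_on X P" and card: "2 \<le> card P"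
    and far: "\<And>C D a b. \<lbrakk>C \<in> P; D \<in> P; C \<noteq> D; a \<in> C; b \<in> D\<rbrakk> \<Longrightarrow> r \<le> \<rho> a b"
  shows "r \<le> clustering_spacing \<rho> P"
proof -
  let ?I = "{(C, D). C \<in> P \<and> D \<in> P \<and> C \<noteq> D}"
  obtain C where C: "C \<in> P"
    using card by fastforce
  have "\<not> P \<subseteq> {C}"
    using card card_mono[of "{C}" P] by auto
  then have ne: "?I \<noteq> {}"
    using C by blast
  have "r \<le> (MIN (a, b) \<in> C \<times> D. \<rho> a b)" if "C \<in> P" "D \<in> P" "C \<noteq> D" for C D
  proof -
    have "finite (C \<times> D)"
      using finite_block[OF X] that by simp
    moreover have "C \<times> D \<noteq> {}"
      using partition_onD3[OF X(2)] that by auto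
    ultimately show ?thesis
      using far[OF that] by (subst Min_ge_iff) auto
  qed
  then show ?thesis
    unfolding clustering_spacing_def
    using finite_pairs_of_partition[OF X] ne by (subst Min_ge_iff) auto
qed

lemma clustering_spacing_le:
  assumes X: "finite X" "partition_on X P"
    and CD: "C \<in> P" "D \<in> P" "C \<noteq> D" "a \<in> C" "b \<in> D" and near: "\<rho> a b \<le> r"
  shows "clustering_spacing \<rho> P \<le> r"
proof -
  have "clustering_spacing \<rho> P \<le> (MIN (a, b) \<in> C \<times> D. \<rho> a b)"
    unfolding clustering_spacing_def
    by (rule Min_le) (use finite_pairs_of_partition[OF X] CD in \<open>auto intro!: image_eqI[of _ _ "(C, D)"]\<close>)
  also have "\<dots> \<le> \<rho> a b"
    by (rule Min_le) (use finite_block[OF X] CD in \<open>auto intro!: image_eqI[of _ _ "(a, b)"]\<close>)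
  finally show ?thesis using near by simp
qed

lemma slc_cost_ge:
  assumes "finite X" "partition_on X P" "card P = k" "2 \<le> k"
    and "\<And>C D a b. \<lbrakk>C \<in> P; D \<in> P; C \<noteq> D; a \<in> C; b \<in> D\<rbrakk> \<Longrightarrow> r \<le> \<rho> a b"
  shows "r \<le> slc_cost \<rho> k X"
proof -
  have "r \<le> clustering_spacing \<rho> P"
    by (rule clustering_spacing_ge[OF assms(1,2)]) (use assms in auto)
  also have "\<dots> \<le> slc_cost \<rho> k X"
    unfolding slc_cost_def
    by (rule Max_ge) (use finite_partitions_of_card[OF assms(1)] assms in auto)
  finally show ?thesis .
qed

text \<open>One close pair in different clusters of every \<open>k\<close>-clustering bounds each
  spacing; \<open>ex\<close> keeps the maximum from ranging over the empty set.\<close>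

lemma slc_cost_le:
  assumes "finite X" and ex: "\<exists>P. partition_on X P \<and> card P = k"
    and "\<And>P. \<lbrakk>partition_on X P; card P = k\<rbrakk> \<Longrightarrow>
           \<exists>C\<in>P. \<exists>D\<in>P. C \<noteq> D \<and> (\<exists>a\<in>C. \<exists>b\<in>D. \<rho> a b \<le> r)"
  shows "slc_cost \<rho> k X \<le> r"
proof -
  have "clustering_spacing \<rho> P \<le> r" if "partition_on X P" "card P = k" for P
    using assms(3)[OF that] clustering_spacing_le[OF assms(1) that(1)] by blast
  then show ?thesis
    unfolding slc_cost_def
    using finite_partitions_of_card[OF assms(1)] ex by (subst Max_le_iff) auto
qed

text \<open>This is the shape of all clusterings constructed below: the graph points are cut in two
  and every isolated point forms its own cluster.\<close>

lemma partition_on_two_blocks_and_singletons: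
  assumes "A \<noteq> {}" "B \<noteq> {}" "A \<inter> B = {}" "(A \<union> B) \<inter> Y = {}"
  shows "partition_on (A \<union> B \<union> Y) (insert A (insert B ((\<lambda>y. {y}) ` Y)))"
  using assms by (intro partition_onI) (auto simp: disjnt_def)

lemma card_two_blocks_and_singletons:
  assumes "finite Y" "A \<noteq> {}" "B \<noteq> {}" "A \<inter> B = {}" "(A \<union> B) \<inter> Y = {}"
  shows "card (insert A (insert B ((\<lambda>y. {y}) ` Y))) = card Y + 2"
proof -
  have "A \<notin> insert B ((\<lambda>y. {y}) ` Y)" "B \<notin> (\<lambda>y. {y}) ` Y"
    using assms by auto
  moreover have "card ((\<lambda>y. {y}) ` Y) = card Y"
    by (rule card_image) auto
  ultimately show ?thesis
    using assms(1) by simp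
qed

text \<open>Every block other than \<open>C\<close> misses \<open>M\<close>, hence contains a point
  of \<open>Y\<close>. Sending each point of \<open>Y\<close> to its block therefore reaches all
  blocks except possibly \<open>C\<close>.\<close>

lemma card_partition_le_Suc:
  assumes P: "partition_on (M \<union> Y) P" and "finite Y" and C: "C \<in> P" "M \<subseteq> C"
  shows "card P \<le> Suc (card Y)"
proof -
  define cl where "cl y = (SOME D. D \<in> P \<and> y \<in> D)" for y
  have "P \<subseteq> insert C (cl ` Y)"
  proof
    fix D assume D: "D \<in> P"
    obtain y where y: "y \<in> D"
      using partition_onD3[OF P] D by (metis ex_in_conv)
    show "D \<in> insert C (cl ` Y)"
    proof (cases "y \<in> M")
      case True
      then show ?thesis
        using y C D partition_onD2[OF P] unfolding disjoint_def by blast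
    next
      case False
      then have "y \<in> Y"
        using y D partition_onD1[OF P] by auto
      moreover have "cl y \<in> P \<and> y \<in> cl y"
        unfolding cl_def by (rule someI_ex) (use y D in blast)
      then have "cl y = D"
        using y D partition_onD2[OF P] unfolding disjoint_def by blast
      ultimately show ?thesis by blast
    qed
  qed
  then have "card P \<le> card (insert C (cl ` Y))"
    using \<open>finite Y\<close> by (intro card_mono) auto
  also have "\<dots> \<le> Suc (card Y)"
    using \<open>finite Y\<close> card_image_le[of Y cl] by (simp add: card_insert_if)
  finally show ?thesis .
qed


section \<open>Graphs as planar point sets\<close>

definition nat_point :: "nat \<Rightarrow> nat \<Rightarrow> real ^ 2" where
  "nat_point a b = vector [real a, real b]"

text \<open>Sorting the end points makes the image a function of the unordered edge and keeps it off
  the diagonal, where the vertices are placed.\<close>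

definition edge_point :: "nat set \<Rightarrow> real ^ 2" where
  "edge_point e = nat_point (Min e) (Max e)"

definition diagonal_points :: "nat \<Rightarrow> (real ^ 2) list" where
  "diagonal_points m = map (\<lambda>u. nat_point u u) [0..<m]"

lemma nat_point_nth [simp]:
  "nat_point a b $ 1 = real a" "nat_point a b $ 2 = real b"
  by (simp_all add: nat_point_def)

lemma nat_point_eq_iff [simp]: "nat_point a b = nat_point a' b' \<longleftrightarrow> a = a' \<and> b = b'"
  by (auto simp: vec_eq_iff forall_2)

lemma hamming_dist_nat_point:
  "hamming_dist (nat_point a b) (nat_point a' b') = of_bool (a \<noteq> a') + of_bool (b \<noteq> b')"
proof -
  have "{i. nat_point a b $ i \<noteq> nat_point a' b' $ i}
      = (if a \<noteq> a' then {1} else {}) \<union> (if b \<noteq> b' then {2} else {})"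
    using exhaust_2 by (auto split: if_splits) (metis nat_point_nth of_nat_eq_iff)+
  then show ?thesis
    by (simp add: hamming_dist_def)
qed

lemma edge_as_Min_Max:
  fixes e :: "nat set"
  assumes "card e = 2"
  shows "Min e < Max e" "e = {Min e, Max e}"
proof -
  obtain x y where e: "e = {x, y}" "x \<noteq> y"
    using assms by (auto simp: card_2_iff)
  show "Min e < Max e" "e = {Min e, Max e}"
    using e by (auto simp: min_def max_def)
qed

lemma edge_point_doubleton:
  assumes "u < v"
  shows "edge_point {u, v} = nat_point u v"
  using assms by (simp add: edge_point_def)

section \<open>The clustering cost of the point set of a graph\<close>

context
  fixes n k :: nat and E :: "nat set set"
  assumes edges: "\<And>e. e \<in> E \<Longrightarrow> e \<subseteq> {..<n} \<and> card e = 2"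
    and n: "2 \<le> n" and k: "2 \<le> k"
begin

private definition graph_points :: "(real ^ 2) set" where
  "graph_points = edge_point ` E \<union> (\<lambda>u. nat_point u u) ` {..<n}"

text \<open>Coordinates from \<open>n\<close> on occur in no graph point, so these points have
  distance 2 from all others. Their number \<open>k - 2\<close> leaves exactly two clusters for the
  graph points.\<close>

private definition isolated_points :: "(real ^ 2) set" where
  "isolated_points = (\<lambda>u. nat_point u u) ` {n..<n + (k - 2)}"

private lemma finite_edges: "finite E"
  by (rule finite_subset[of _ "Pow {..<n}"]) (use edges in auto)

private lemma finite_graph_points: "finite graph_points"
  using finite_edges by (simp add: graph_points_def)

private lemma finite_isolated_points: "finite isolated_points"
  by (simp add: isolated_points_def)

private lemma card_isolated_points: "card isolated_points = k - 2"
  unfolding isolated_points_def by (subst card_image) (auto simp: inj_on_def)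

private lemma graph_points_cases:
  assumes "x \<in> graph_points"
  obtains a b where "x = nat_point a b" "a < n" "b < n" "a = b \<or> {a, b} \<in> E"
proof (cases "x \<in> edge_point ` E")
  case True
  then obtain e where e: "e \<in> E" "x = edge_point e" by blast
  have "e = {Min e, Max e}" "e \<subseteq> {..<n}"
    using edges[OF e(1)] edge_as_Min_Max by auto
  then show ?thesis
    using that[of "Min e" "Max e"] e by (metis edge_point_def insert_subset lessThan_iff)
next
  case False
  then show ?thesis
    using assms that by (auto simp: graph_points_def)
qed

private lemma disjoint_graph_isolated: "graph_points \<inter> isolated_points = {}"
  by (auto simp: isolated_points_def elim!: graph_points_cases)

private lemma split_of_graph_points:
  assumes "A \<subseteq> graph_points" "A \<noteq> {}" "graph_points - A \<noteq> {}"
  shows "partition_on (graph_points \<union> isolated_points)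
           (insert A (insert (graph_points - A) ((\<lambda>y. {y}) ` isolated_points)))"
    and "card (insert A (insert (graph_points - A) ((\<lambda>y. {y}) ` isolated_points))) = k"
proof -
  have eq: "A \<union> (graph_points - A) = graph_points"
    using assms(1) by blast
  show "partition_on (graph_points \<union> isolated_points)
           (insert A (insert (graph_points - A) ((\<lambda>y. {y}) ` isolated_points)))"
    using partition_on_two_blocks_and_singletons[of A "graph_points - A" isolated_points]
      assms disjoint_graph_isolated eq by simp
  show "card (insert A (insert (graph_points - A) ((\<lambda>y. {y}) ` isolated_points))) = k"
    using card_two_blocks_and_singletons[of isolated_points A "graph_points - A"]
      assms disjoint_graph_isolated eq finite_isolated_points card_isolated_points k by simp
qed

text \<open>The graph points are cut along a connected component. The two coordinates of a graph
  point are equal or adjacent, so they lie on the same side of the cut, and points on opposite sides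
  agree in neither coordinate.\<close>

private lemma slc_cost_disconnected:
  assumes "\<not> graph_connected {..<n} E"
  shows "2 \<le> slc_cost hamming_dist k (graph_points \<union> isolated_points)"
proof -
  define r where "r = {(a, b). {a, b} \<in> E}"
  obtain u v where uv: "u < n" "v < n" "(u, v) \<notin> r\<^sup>*"
    using assms by (auto simp: graph_connected_def r_def)
  define R where "R = {w. (u, w) \<in> r\<^sup>*}"
  \<comment> \<open>Edges are unordered, so the step relation is symmetric and \<open>R\<close> is
    closed in both directions.\<close>
  have closed: "a \<in> R \<longleftrightarrow> b \<in> R" if "{a, b} \<in> E" for a b
  proof -
    have "(a, b) \<in> r" "(b, a) \<in> r"
      using that by (auto simp: r_def insert_commute)
    then show ?thesis
      unfolding R_def by (auto intro: rtrancl_into_rtrancl)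
  qed
  define A where "A = {x \<in> graph_points. \<exists>a\<in>R. x $ 1 = real a}"
  have A_iff: "nat_point a b \<in> A \<longleftrightarrow> a \<in> R" "a \<in> R \<longleftrightarrow> b \<in> R"
    if "nat_point a b \<in> graph_points" for a b
    using that closed by (auto simp: A_def elim!: graph_points_cases)
  have diag: "nat_point w w \<in> graph_points" if "w < n" for w
    using that by (auto simp: graph_points_def)
  have "nat_point u u \<in> A" "nat_point v v \<in> graph_points - A"
    using uv diag A_iff by (auto simp: R_def)
  then have ne: "A \<subseteq> graph_points" "A \<noteq> {}" "graph_points - A \<noteq> {}"
    by (auto simp: A_def)
  let ?P = "insert A (insert (graph_points - A) ((\<lambda>y. {y}) ` isolated_points))"
  show ?thesis
  proof (rule slc_cost_ge[OF _ split_of_graph_points[OF ne] k])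
    fix C D x y assume CD: "C \<in> ?P" "D \<in> ?P" "C \<noteq> D" "x \<in> C" "y \<in> D"
    have mem: "x \<in> graph_points \<union> isolated_points" "y \<in> graph_points \<union> isolated_points"
      using CD ne by auto
    have far: "2 \<le> hamming_dist p q" if "p \<in> graph_points" "q \<in> isolated_points" for p q
      using that by (auto simp: isolated_points_def hamming_dist_nat_point elim!: graph_points_cases)
    have far': "2 \<le> hamming_dist p q" if "q \<in> graph_points" "p \<in> isolated_points" for p q
      using that by (auto simp: isolated_points_def hamming_dist_nat_point elim!: graph_points_cases)
    \<comment> \<open>The third alternative absorbs both mixed cases.\<close>
    consider "x \<in> graph_points" "y \<in> graph_points" | "x \<in> isolated_points" "y \<in> isolated_points"
      | "2 \<le> hamming_dist x y"
      using mem far far' by blast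
    then show "2 \<le> hamming_dist x y"
    proof cases
      case 1
      then have xy: "x \<in> A \<longleftrightarrow> y \<notin> A"
        using CD disjoint_graph_isolated by blast
      obtain a b where x: "x = nat_point a b"
        using 1(1) by (rule graph_points_cases)
      obtain a' b' where y: "y = nat_point a' b'"
        using 1(2) by (rule graph_points_cases)
      have "a \<noteq> a'" "b \<noteq> b'"
        using xy 1 A_iff unfolding x y by metis+
      then show ?thesis
        by (simp add: x y hamming_dist_nat_point)
    next
      case 2
      then have "x \<noteq> y"
        using CD disjoint_graph_isolated ne by auto
      then show ?thesis
        using 2 by (auto simp: isolated_points_def hamming_dist_nat_point)
    qed
  qed (use finite_graph_points finite_isolated_points in auto)
qed

text \<open>If all points in different clusters were more than 1 apart, walking along the edges
  would collect all graph points in a single cluster, leaving room for at most \<open>k - 1\<close>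
  clusters.\<close>

private lemma slc_cost_connected:
  assumes conn: "graph_connected {..<n} E"
  shows "slc_cost hamming_dist k (graph_points \<union> isolated_points) \<le> 1"
proof (rule slc_cost_le)
  \<comment> \<open>Any clustering into \<open>k\<close> parts will do here; splitting off one
    vertex point works because \<open>2 \<le> n\<close>.\<close>
  have "nat_point 0 0 \<in> graph_points" "nat_point 1 1 \<in> graph_points - {nat_point 0 0}"
    using n by (auto simp: graph_points_def)
  then show "\<exists>P. partition_on (graph_points \<union> isolated_points) P \<and> card P = k"
    using split_of_graph_points[of "{nat_point 0 0}"] by blast
next
  fix P assume P: "partition_on (graph_points \<union> isolated_points) P" "card P = k"
  show "\<exists>C\<in>P. \<exists>D\<in>P. C \<noteq> D \<and> (\<exists>a\<in>C. \<exists>b\<in>D. hamming_dist a b \<le> 1)"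
  proof (rule ccontr)
    assume contr: "\<not> ?thesis"
    have near: "y \<in> C" if "C \<in> P" "x \<in> C" "hamming_dist x y \<le> 1" and y: "y \<in> graph_points" for C x y
    proof -
      obtain D where "D \<in> P" "y \<in> D"
        using y partition_onD1[OF P(1)] by blast
      then show ?thesis
        using contr that by blast
    qed
    have zero: "nat_point 0 0 \<in> graph_points"
      using n by (auto simp: graph_points_def)
    then obtain C where C: "C \<in> P" "nat_point 0 0 \<in> C"
      using partition_onD1[OF P(1)] by blast
    have step: "nat_point w w \<in> C" if "nat_point u u \<in> C" "{u, w} \<in> E" for u w
    proof -
      \<comment> \<open>The edge point shares one coordinate with each end point, so it links their
        diagonal points by two hops of length at most 1.\<close>
      define p where "p = edge_point {u, w}"
      have uw: "u \<noteq> w" "w < n"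
        using edges[OF that(2)] by auto
      have "p = nat_point u w \<or> p = nat_point w u"
        using uw edge_point_doubleton[of u w] edge_point_doubleton[of w u]
        by (cases u w rule: linorder_cases) (auto simp: p_def insert_commute)
      then have "hamming_dist (nat_point u u) p \<le> 1" "hamming_dist p (nat_point w w) \<le> 1"
        by (auto simp: hamming_dist_nat_point)
      moreover have "p \<in> graph_points" "nat_point w w \<in> graph_points"
        using that uw by (auto simp: p_def graph_points_def)
      ultimately show ?thesis
        using near C(1) that(1) by blast
    qed
    have diag: "nat_point w w \<in> C" if "w < n" for w
    proof -
      have "(0, w) \<in> {(a, b). {a, b} \<in> E}\<^sup>*"
        using conn that n by (auto simp: graph_connected_def)
      then show ?thesis
        by induction (use C step in auto)
    qed
    have "graph_points \<subseteq> C"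
    proof
      fix x assume x: "x \<in> graph_points"
      then obtain a b where ab: "x = nat_point a b" "a < n"
        by (rule graph_points_cases)
      show "x \<in> C"
        by (rule near[OF C(1) diag[OF ab(2)] _ x]) (simp add: ab hamming_dist_nat_point)
    qed
    then have "card P \<le> Suc (k - 2)"
      using card_partition_le_Suc[OF P(1) finite_isolated_points C(1)] card_isolated_points by simp
    then show False
      using P(2) k by simp
  qed
qed (use finite_graph_points finite_isolated_points in auto)

text \<open>The cost is at most 1 or at least 2. In the first case \<open>v\<close> is at most 1
  because the guarantee never overestimates; in the second, \<open>v \<le> 1\<close> would give
  \<open>2 \<le> \<beta>\<close>.\<close>

lemma approximation_decides_connectivity:
  assumes es: "set es = E" and "1 \<le> \<beta>" "\<beta> < 2"
    and "approximates \<beta>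
           (slc_cost hamming_dist k (set (map edge_point es @ diagonal_points (n + (k - 2))))) v"
  shows "v \<le> 1 \<longleftrightarrow> graph_connected {..<n} E"
proof -
  have "{0..<n + (k - 2)} = {..<n} \<union> {n..<n + (k - 2)}"
    by auto
  then have "set (map edge_point es @ diagonal_points (n + (k - 2))) = graph_points \<union> isolated_points"
    by (simp add: es diagonal_points_def graph_points_def isolated_points_def image_Un Un_assoc)
  then have v: "v \<le> slc_cost hamming_dist k (graph_points \<union> isolated_points)"
      "slc_cost hamming_dist k (graph_points \<union> isolated_points) \<le> \<beta> * v"
    using assms(4) by (simp_all add: approximates_def)
  show ?thesis
  proof (cases "graph_connected {..<n} E")
    case True
    then show ?thesis
      using v slc_cost_connected by simp
  next
    case False
    have "\<not> v \<le> 1"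
    proof
      assume "v \<le> 1"
      then have "\<beta> * v \<le> \<beta> * 1"
        using assms(2) by (intro mult_left_mono) auto
      then show False
        using v slc_cost_disconnected[OF False] assms(3) by simp
    qed
    then show ?thesis
      using False by simp
  qed
qed

end

section \<open>Admissibility of the constructed list as a clustering input\<close>

lemma distinct_reduction:
  assumes "distinct es" "\<And>e. e \<in> set es \<Longrightarrow> card e = 2"
  shows "distinct (map edge_point es @ diagonal_points m)"
proof -
  have "inj_on edge_point (set es)"
  proof (rule inj_onI)
    fix e f assume "e \<in> set es" "f \<in> set es" "edge_point e = edge_point f"
    then show "e = f"
      using edge_as_Min_Max(2)[of e] edge_as_Min_Max(2)[of f] assms(2)
      by (metis edge_point_def nat_point_eq_iff)
  qed
  moreover have "edge_point e \<noteq> nat_point u u" if "e \<in> set es" for e u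
    using edge_as_Min_Max(1)[OF assms(2)[OF that]] by (auto simp: edge_point_def)
  ultimately show ?thesis
    using assms(1) by (auto simp: diagonal_points_def distinct_map inj_on_def)
qed

lemma reduction_coordinates:
  assumes "\<And>e. e \<in> set es \<Longrightarrow> e \<subseteq> {..<n} \<and> card e = 2" "n \<le> m"
    and "x \<in> set (map edge_point es @ diagonal_points m)"
  shows "x $ i \<in> real ` {..<m}"
proof -
  obtain a b where ab: "x = nat_point a b" "a < m" "b < m"
  proof (cases "x \<in> edge_point ` set es")
    case True
    then obtain e where e: "e \<in> set es" "x = edge_point e" by blast
    then have "{Min e, Max e} \<subseteq> {..<n}"
      using assms(1) edge_as_Min_Max by metis
    then show ?thesis
      using that[of "Min e" "Max e"] e assms(2) by (auto simp: edge_point_def)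
  next
    case False
    then show ?thesis
      using assms(3) that by (auto simp: diagonal_points_def)
  qed
  then show ?thesis
    using exhaust_2[of i] by auto
qed


section \<open>Local preprocessing of the input\<close>

text \<open>Runs \<open>B\<close> on \<open>map f xs @ ys\<close> for inputs \<open>xs\<close> of the known length \<open>l\<close>, so that every machine
  knows which elements of \<open>ys\<close> belong to its share.\<close>

definition preprocess ::
  "('z \<Rightarrow> 'a) \<Rightarrow> 'a list \<Rightarrow> nat \<Rightarrow> ('b \<Rightarrow> 'c) \<Rightarrow> ('a, 'b) mpc_program \<Rightarrow> ('z, 'c) mpc_program" where
  "preprocess f ys l g B =
     \<lparr> machines = machines B, rounds = rounds B,
       load = (\<lambda>i zs. load B i (map f zs @ nths ys {j. (j + l) mod machines B = i})),
       step = step B,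
       answer = (\<lambda>mem inbox. g (answer B mem inbox)) \<rparr>"

lemma preprocess_simps [simp]:
  "machines (preprocess f ys l g B) = machines B"
  "rounds (preprocess f ys l g B) = rounds B"
  "step (preprocess f ys l g B) = step B"
  by (simp_all add: preprocess_def)

text \<open>Records are dealt out by position. Applying \<open>f\<close> keeps positions, and
  element \<open>j\<close> of \<open>ys\<close> sits at position \<open>j + length xs\<close>, so
  the new share is computable from the old one without communication.\<close>

lemma share_append:
  "share B (map f xs @ ys) i =
     map f (share (preprocess f ys l g B) xs i) @ nths ys {j. (j + length xs) mod machines B = i}"
  by (simp add: share_def nths_append nths_map)

lemma config_preprocess:
  "config (preprocess f ys (length xs) g B) xs r i = config B (map f xs @ ys) r i"
proof (induction r arbitrary: i)
  case 0
  have "load (preprocess f ys (length xs) g B) i (share (preprocess f ys (length xs) g B) xs i)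
      = load B i (share B (map f xs @ ys) i)"
    unfolding share_append[where l = "length xs" and g = g] by (simp add: preprocess_def)
  then show ?case by simp
next
  case (Suc r)
  then show ?case by simp
qed

lemma result_preprocess:
  "result (preprocess f ys (length xs) g B) xs = g (result B (map f xs @ ys))"
  by (simp add: result_def config_preprocess) (simp add: preprocess_def)

text \<open>The runs coincide, so retained data and traffic are unchanged, and the shares of the
  original input are no longer than those of the extended one.\<close>

lemma within_memory_preprocess:
  assumes mem: "within_memory S b B (map f xs @ ys)" and "S \<le> S'" "b' \<le> b"
  shows "within_memory S' b' (preprocess f ys (length xs) g B) xs"
proof -
  let ?A = "preprocess f ys (length xs) g B"
  have "real (length (share ?A xs i) * b') \<le> S'" if "i < machines B" for i
  proof -
    have "length (share ?A xs i) * b' \<le> length (share B (map f xs @ ys) i) * b"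
      unfolding share_append[where l = "length xs" and g = g]
      using assms(3) by (intro mult_le_mono) auto
    then have "real (length (share ?A xs i) * b') \<le> real (length (share B (map f xs @ ys) i) * b)"
      by (simp only: of_nat_le_iff)
    also have "\<dots> \<le> S"
      using mem that by (auto simp: within_memory_def)
    finally show ?thesis
      using assms(2) by simp
  qed
  moreover have "sent ?A xs r i = sent B (map f xs @ ys) r i" for r i
    by (simp add: sent_def config_preprocess)
  ultimately show ?thesis
    using mem order_trans[OF _ assms(2)] unfolding within_memory_def config_preprocess
    by simp
qed


section \<open>Growth estimates\<close>

lemma le_two_power_id_bits:
  assumes "0 < n"
  shows "n \<le> 2 ^ id_bits n"
proof -
  have "real n = 2 powr log 2 (real n)"
    using assms by simp
  also have "\<dots> \<le> 2 powr real (id_bits n)"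
    by (intro powr_mono) (simp_all add: id_bits_def real_nat_ceiling_ge)
  also have "\<dots> = real (2 ^ id_bits n)"
    by (simp add: powr_realpow)
  finally show ?thesis
    by (simp only: of_nat_le_iff)
qed

lemma id_bits_mono:
  assumes "0 < n" "n \<le> m"
  shows "id_bits n \<le> id_bits m"
  unfolding id_bits_def using assms by (intro nat_mono ceiling_mono) auto

text \<open>The reduction enlarges the size parameter linearly, hence eventually to at most its
  square; word lengths then at most double.\<close>

lemma id_bits_le_double:
  assumes "0 < n" "0 < m" "m \<le> n * n"
  shows "id_bits m \<le> 2 * id_bits n"
proof -
  have "real m \<le> real n * real n"
    using assms(3) by (metis of_nat_le_iff of_nat_mult)
  then have "log 2 (real m) \<le> log 2 (real n * real n)"
    using assms by simp
  also have "\<dots> = 2 * log 2 (real n)"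
    using assms by (simp add: log_mult)
  also have "\<dots> \<le> real (2 * id_bits n)"
    by (simp add: id_bits_def real_nat_ceiling_ge)
  finally have "\<lceil>log 2 (real m)\<rceil> \<le> int (2 * id_bits n)"
    by (simp add: ceiling_le_iff)
  then show ?thesis
    unfolding id_bits_def[of m] by linarith
qed

lemma powr_mult_le:
  fixes \<alpha> :: real
  assumes "0 < \<alpha>" "\<alpha> < 1" "0 < K" "m \<le> K * n"
  shows "real m powr \<alpha> \<le> real K * real n powr \<alpha>"
proof -
  have "real m \<le> real K * real n"
    using assms(4) by (metis of_nat_le_iff of_nat_mult)
  then have "real m powr \<alpha> \<le> (real K * real n) powr \<alpha>"
    using assms by (intro powr_mono2) auto
  also have "\<dots> = real K powr \<alpha> * real n powr \<alpha>"
    by (simp add: powr_mult)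
  also have "\<dots> \<le> real K powr 1 * real n powr \<alpha>"
    using assms by (intro mult_right_mono powr_mono) auto
  finally show ?thesis
    using assms(3) by simp
qed

text \<open>One additional logarithmic factor absorbs the constant \<open>4 * 2 ^ e\<close>, where 4
  comes from \<open>x \<le> 4 * N\<close> and \<open>2 ^ e\<close> from
  \<open>ln x \<le> 2 * ln N\<close>.\<close>

lemma polylog_le:
  fixes N x :: real
  assumes N: "4 \<le> N" and x: "1 \<le> x" "x \<le> 4 * N" and ln: "4 * 2 ^ e \<le> ln N"
  shows "x * ln x ^ e \<le> N * ln N ^ Suc e"
proof -
  have "4 * N \<le> N * N"
    using N by (intro mult_right_mono) auto
  then have "ln x \<le> ln (N * N)"
    using x by (intro ln_mono) linarith+
  also have "\<dots> = 2 * ln N"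
    using N by (simp add: ln_mult)
  finally have "ln x ^ e \<le> (2 * ln N) ^ e"
    using x by (intro power_mono) auto
  then have "x * ln x ^ e \<le> (4 * N) * (2 * ln N) ^ e"
    using x N by (intro mult_mono) auto
  also have "\<dots> = N * ((4 * 2 ^ e) * ln N ^ e)"
    by (simp add: power_mult_distrib)
  also have "\<dots> \<le> N * (ln N * ln N ^ e)"
    using ln N by (intro mult_left_mono mult_right_mono) auto
  finally show ?thesis by simp
qed

text \<open>The size of the clustering instance varies with the number of edges, so the round bound
  is a maximum over a window of sizes. For large \<open>n\<close> the window lies below
  \<open>n * n\<close>, where the logarithm is at most \<open>2 * ln n\<close>.\<close>

lemma Max_window_not_omega_ln:
  fixes T :: "nat \<Rightarrow> nat" and C j :: nat
  assumes "(\<lambda>n. real (T n)) \<in> o(\<lambda>n. ln (real n))"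
  shows "(\<lambda>n. real (Max (T ` {n..n + C * n + j}))) \<notin> \<Omega>(\<lambda>n. ln (real n))"
proof
  let ?M = "\<lambda>n. Max (T ` {n..n + C * n + j})"
  assume "(\<lambda>n. real (?M n)) \<in> \<Omega>(\<lambda>n. ln (real n))"
  then obtain c where c: "0 < c" "eventually (\<lambda>n. c * norm (ln (real n)) \<le> norm (real (?M n))) sequentially"
    by (rule landau_omega.bigE)
  \<comment> \<open>With the factor 2 lost over the window, \<open>c / 3\<close> still yields
    \<open>2 * c / 3 < c\<close>.\<close>
  have "eventually (\<lambda>n. norm (real (T n)) \<le> c / 3 * norm (ln (real n))) sequentially"
    using assms by (rule landau_o.smallD) (use c in simp)
  then obtain N where N: "\<And>n. n \<ge> N \<Longrightarrow> real (T n) \<le> c / 3 * \<bar>ln (real n)\<bar>"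
    by (auto simp: eventually_sequentially)
  have "eventually (\<lambda>n. False) sequentially"
    using c(2) eventually_ge_at_top[of "N + C + j + 2"]
  proof eventually_elim
    case (elim n)
    have "?M n \<in> T ` {n..n + C * n + j}"
      by (rule Max_in) auto
    then obtain m where "?M n = T m" "m \<in> {n..n + C * n + j}"
      by (rule imageE)
    then have m: "?M n = T m" "n \<le> m" "m \<le> n + C * n + j"
      by simp_all
    have "m \<le> (C + 2) * n"
      using m(3) elim by (simp add: algebra_simps)
    also have "\<dots> \<le> n * n"
      using elim by (intro mult_right_mono) auto
    finally have "real m \<le> real n * real n"
      by (metis of_nat_le_iff of_nat_mult)
    moreover have n: "1 < real n" "0 < real m"
      using elim m by auto
    ultimately have "ln (real m) \<le> ln (real n * real n)"
      by simp
    also have "\<dots> = 2 * ln (real n)"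
      using n by (simp add: ln_mult)
    finally have "c / 3 * ln (real m) \<le> c / 3 * (2 * ln (real n))"
      using c by (intro mult_left_mono) auto
    moreover have "real (T m) \<le> c / 3 * ln (real m)"
      using N[of m] m elim by simp
    moreover have "c * ln (real n) \<le> real (T m)"
      using elim m n by simp
    moreover have "0 < c * ln (real n)"
      using c n by simp
    ultimately show False by simp
  qed
  then show False by simp
qed


section \<open>The reduction\<close>

text \<open>A clustering instance has as many records as its size parameter, so \<open>A\<close>
  receives the same number twice. In the word factor, 2 pays for longer words and
  \<open>C + 2\<close> for the larger number of words per machine.\<close>

lemma connectivity_from_slc:
  fixes A :: "nat \<Rightarrow> nat \<Rightarrow> (real ^ 2, real) mpc_program"
  assumes \<alpha>: "0 < \<alpha>" "\<alpha> < 1" and k: "2 \<le> k" and \<beta>: "1 \<le> \<beta>" "\<beta> < 2"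
    and A: "mpc_solves \<alpha> c (hamming_slc c k \<beta>) T A"
  shows "mpc_solves \<alpha> (2 * c * (C + 2)) (sparse_connectivity C)
           (\<lambda>n. Max (T ` {n..n + C * n + (k - 2)}))
           (\<lambda>n l. preprocess edge_point (diagonal_points (n + (k - 2))) l (\<lambda>v. v \<le> 1)
                    (A (l + (n + (k - 2))) (l + (n + (k - 2)))))"
    (is "mpc_solves _ ?c _ ?T ?A")
proof -
  let ?Q = "hamming_slc c k \<beta> :: (real ^ 2, real) problem"
  let ?G = "sparse_connectivity C"
  define size where "size n l = l + (n + (k - 2))" for n l
  define red where "red n es = map edge_point es @ diagonal_points (n + (k - 2))" for n es
  have c: "0 < c"
    using A by (simp add: mpc_solves_def)
  have len: "length (red n es) = size n (length es)" for n es
    by (simp add: red_def size_def diagonal_points_def)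
  have red: "red n es \<in> instances ?Q (size n (length es))" if es: "es \<in> instances ?G n" "0 < n" for n es
  proof -
    let ?m = "size n (length es)"
    have "n + (k - 2) \<le> ?m"
      by (simp add: size_def)
    also have "?m \<le> 2 ^ id_bits ?m"
      using es(2) by (intro le_two_power_id_bits) (simp add: size_def)
    also have "\<dots> \<le> 2 ^ word_bits c ?m"
      using c by (intro power_increasing) (auto simp: word_bits_def)
    finally have "real ` {..<n + (k - 2)} \<subseteq> real ` {..<2 ^ word_bits c ?m}"
      by (intro image_mono) auto
    moreover have "\<forall>x\<in>set (red n es). \<forall>i. x $ i \<in> real ` {..<n + (k - 2)}"
      unfolding red_def using es
      by (intro ballI allI reduction_coordinates[where es = es and n = n])
         (auto simp: sparse_connectivity_def)
    moreover have "distinct (red n es)"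
      unfolding red_def using es by (intro distinct_reduction) (auto simp: sparse_connectivity_def)
    ultimately show ?thesis
      using len by (auto simp: hamming_slc_def)
  qed
  have size_bounds: "n \<le> size n (length es)" "size n (length es) \<le> n + C * n + (k - 2)"
    if "es \<in> instances ?G n" for n es
    using that by (auto simp: size_def sparse_connectivity_def)
  obtain e N1 where N1: "\<And>n xs. \<lbrakk>N1 \<le> n; xs \<in> instances ?Q n\<rbrakk> \<Longrightarrow>
      real (machines (A n (length xs))) * real n powr \<alpha>
        \<le> real (input_size ?Q n (length xs)) * ln (real (input_size ?Q n (length xs))) ^ e"
    using A unfolding mpc_solves_def eventually_sequentially by blast
  obtain N2 where N2: "\<And>n xs. \<lbrakk>N2 \<le> n; xs \<in> instances ?Q n\<rbrakk> \<Longrightarrow>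
      0 < machines (A n (length xs)) \<and> rounds (A n (length xs)) \<le> T n \<and>
      within_memory (real n powr \<alpha> * real (word_bits c n)) (record_bits ?Q n) (A n (length xs)) xs \<and>
      valid ?Q n xs (result (A n (length xs)) xs)"
    using A unfolding mpc_solves_def eventually_sequentially by blast
  have "filterlim (\<lambda>n. ln (real n)) at_top sequentially"
    by (rule filterlim_compose[OF ln_at_top filterlim_real_sequentially])
  then have "\<forall>\<^sub>F n in sequentially. 4 * 2 ^ e \<le> ln (real n)"
    by (simp add: filterlim_at_top)
  then have total: "\<forall>\<^sub>F n in sequentially. \<forall>es \<in> instances ?G n.
        real (machines (?A n (length es))) * real n powr \<alpha>
          \<le> real (input_size ?G n (length es)) * ln (real (input_size ?G n (length es))) ^ Suc e"
    using eventually_ge_at_top[of "N1 + k + 4"]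
  proof eventually_elim
    case (elim n)
    show ?case
    proof
      fix es assume es: "es \<in> instances ?G n"
      let ?m = "size n (length es)" and ?N = "n + length es"
      let ?B = "A ?m ?m"
      have "real (machines ?B) * real n powr \<alpha> \<le> real (machines ?B) * real ?m powr \<alpha>"
        using \<alpha> size_bounds[OF es] by (intro mult_left_mono powr_mono2) auto
      also have "\<dots> \<le> real (2 * ?m) * ln (real (2 * ?m)) ^ e"
        using N1[OF _ red[OF es]] size_bounds[OF es] elim by (simp add: len hamming_slc_def)
      also have "\<dots> \<le> real ?N * ln (real ?N) ^ Suc e"
      \<comment> \<open>Here \<open>x\<close> is \<open>2 * ?m\<close>, as a planar input of
        \<open>?m\<close> points has size \<open>2 * ?m\<close>; it is at most \<open>4 * ?N\<close>
        once \<open>n\<close> exceeds \<open>k\<close>.\<close>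
      proof (rule polylog_le)
        have "ln (real n) \<le> ln (real ?N)"
          using elim by simp
        then show "4 * 2 ^ e \<le> ln (real ?N)"
          using elim by linarith
        have "2 * ?m \<le> 4 * ?N"
          using elim by (simp add: size_def)
        then show "real (2 * ?m) \<le> 4 * real ?N"
          by linarith
      qed (use elim in \<open>auto simp: size_def\<close>)
      finally show "real (machines (?A n (length es))) * real n powr \<alpha>
          \<le> real (input_size ?G n (length es)) * ln (real (input_size ?G n (length es))) ^ Suc e"
        by (simp add: sparse_connectivity_def size_def)
    qed
  qed
  have "\<forall>\<^sub>F n in sequentially. \<forall>es \<in> instances ?G n.
        0 < machines (?A n (length es)) \<and> rounds (?A n (length es)) \<le> ?T n \<and>
        within_memory (real n powr \<alpha> * real (word_bits ?c n)) (record_bits ?G n)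
          (?A n (length es)) es \<and>
        valid ?G n es (result (?A n (length es)) es)"
    using eventually_ge_at_top[of "N2 + k + C + 2"]
  proof eventually_elim
    case (elim n)
    show ?case
    proof
      fix es assume es: "es \<in> instances ?G n"
      let ?m = "size n (length es)"
      let ?B = "A ?m ?m"
      have B: "0 < machines ?B" "rounds ?B \<le> T ?m"
          "within_memory (real ?m powr \<alpha> * real (word_bits c ?m)) (record_bits ?Q ?m) ?B (red n es)"
          "valid ?Q ?m (red n es) (result ?B (red n es))"
        using N2[OF _ red[OF es]] size_bounds[OF es] elim by (auto simp: len)
      have m: "?m \<le> (C + 2) * n"
        using size_bounds(2)[OF es] elim by (simp add: algebra_simps)
      also have "\<dots> \<le> n * n"
        using elim by (intro mult_right_mono) auto
      finally have "id_bits ?m \<le> 2 * id_bits n"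
        using elim size_bounds(1)[OF es] by (intro id_bits_le_double) auto
      then have "word_bits c ?m \<le> 2 * c * id_bits n"
        by (simp add: word_bits_def)
      then have "real ?m powr \<alpha> * real (word_bits c ?m)
          \<le> (real (C + 2) * real n powr \<alpha>) * real (2 * c * id_bits n)"
        using \<alpha> m by (intro mult_mono powr_mult_le of_nat_mono) auto
      also have "\<dots> = real n powr \<alpha> * real (word_bits ?c n)"
        by (simp add: word_bits_def algebra_simps)
      finally have S: "real ?m powr \<alpha> * real (word_bits c ?m) \<le> real n powr \<alpha> * real (word_bits ?c n)" .
      \<comment> \<open>An edge record must be no longer than a point record, so that the memory
        bound on shares carries over.\<close>
      have "id_bits n \<le> c * id_bits ?m"
        using id_bits_mono[of n ?m] size_bounds(1)[OF es] elim c
        by (metis add_gr_0 le_trans less_le_trans mult_le_mono1 nat_mult_1 One_nat_def Suc_leI pos2)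
      then have "record_bits ?G n \<le> record_bits ?Q ?m"
        by (simp add: sparse_connectivity_def hamming_slc_def word_bits_def)
      then have "within_memory (real n powr \<alpha> * real (word_bits ?c n)) (record_bits ?G n)
          (?A n (length es)) es"
        using B(3) S unfolding red_def size_def by (intro within_memory_preprocess)
      moreover have "T ?m \<le> ?T n"
        using size_bounds[OF es] by (intro Max_ge) auto
      moreover have "result ?B (red n es) \<le> 1 \<longleftrightarrow> graph_connected {..<n} (set es)"
        by (rule approximation_decides_connectivity[where es = es, OF _ _ k refl \<beta>])
           (use B(4) es elim in \<open>auto simp: sparse_connectivity_def hamming_slc_def red_def\<close>)
      then have "valid ?G n es (result (?A n (length es)) es)"
        by (simp add: result_preprocess sparse_connectivity_def red_def size_def)
      ultimately show "0 < machines (?A n (length es)) \<and> rounds (?A n (length es)) \<le> ?T n \<and>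
        within_memory (real n powr \<alpha> * real (word_bits ?c n)) (record_bits ?G n)
          (?A n (length es)) es \<and>
        valid ?G n es (result (?A n (length es)) es)"
        using B(1,2) by (simp add: size_def)
    qed
  qed
  moreover have "0 < ?c"
    using c by simp
  ultimately show ?thesis
    unfolding mpc_solves_def using total by (intro conjI exI[of _ "Suc e"])
qed

theorem theorem5:
  fixes \<alpha> \<beta> :: real and k :: nat
  assumes "sparse_connectivity_conjecture"
    and "0 < \<alpha>" and "\<alpha> < 1"
    and "2 \<le> k"
    and "1 \<le> \<beta>" and "\<beta> < 2"
  shows "\<not> (\<exists>(c::nat) (T :: nat \<Rightarrow> nat) (A :: nat \<Rightarrow> nat \<Rightarrow> (real ^ 2, real) mpc_program).
            mpc_solves \<alpha> c (hamming_slc c k \<beta>) T A \<and>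
            (\<lambda>n. real (T n)) \<in> o(\<lambda>n. ln (real n)))"
proof safe
  fix c :: nat and T :: "nat \<Rightarrow> nat" and A :: "nat \<Rightarrow> nat \<Rightarrow> (real ^ 2, real) mpc_program"
  assume A: "mpc_solves \<alpha> c (hamming_slc c k \<beta>) T A"
    and T: "(\<lambda>n. real (T n)) \<in> o(\<lambda>n. ln (real n))"
  \<comment> \<open>The conjecture picks the edge density \<open>C\<close> for the given \<alpha>;
    the reduction works for every \<open>C\<close>.\<close>
  obtain C where C: "\<And>c T A. mpc_solves \<alpha> c (sparse_connectivity C) T A \<Longrightarrow>
      (\<lambda>n. real (T n)) \<in> \<Omega>(\<lambda>n. ln (real n))"
    using assms(1-3) unfolding sparse_connectivity_conjecture_def by blast
  show False
    using C[OF connectivity_from_slc[OF assms(2-6) A]] Max_window_not_omega_ln[OF T] by blast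
qed

end
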